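(* Let $\mathcal G=(V,E)$ be a graph, $\mathcal V_0\subseteq V$ a nonempty set of vertices with distance partition $(\mathcal V_n)_{n\ge0}$ and associated quantum decomposition $(A^+,A^0,A^-)$ of the adjacency matrix $A$. If $\Xi$ is an orthogonal J-vacuum set which is generating and distance-adapted, then $l_2(V)=\bigoplus_{\xi\in\Xi}[\mathcal A\xi]$ (orthogonal direct sum of the subspaces $[\mathcal A\xi]$).
   Context: A graph is non-oriented, connected, locally finite, simple, with nonempty edge set. Distance partition: $\mathcal V_n=\{v: d(v,\mathcal V_0)=n\}$, $d(v,\mathcal V_0)=\min_{v_0\in\mathcal V_0}d(v,v_0)$. Quantum decomposition: for $x\in\mathcal V_n$, $A^+\delta(x)=\sum_{y\sim x,\,y\in\mathcal V_{n+1}}\delta(y)$, $A^0\delta(x)=\sum_{y\sim x,\,y\in\mathcal V_n}\delta(y)$, $A^-\delta(x)=\sum_{y\sim x,\,y\in\mathcal V_{n-1}}\delta(y)$, $A=A^++A^0+A^-$. Vacuum vector: nonzero $\xi\in l_2(V)$ with $A^-\xi=0$. J-vacuum vector: a vacuum vector $\xi$ with $A^-A^+(A^{+n}\xi)=\omega_nA^{+n}\xi$ and $A^0A^{+n}\xi=\alpha_nA^{+n}\xi$ for all $n\ge0$ ($\alpha_n\in\mathbb R$, $\omega_n\ge0$; zero after the first $m$ with $A^{+m}\xi=0$). Orthogonal J-vacuum set: set of mutually orthogonal J-vacuum vectors. Distance-adapted: $\Xi=\bigcup_n\Xi_n$ with $\Xi_n\subseteq l_2(\mathcal V_n)$. Generating: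 with $B_0=\Xi_0$ and $B_{n+1}=(\{A^+b:b\in B_n\}\cup\Xi_{n+1})\setminus\{0\}$, each $B_n$ is a basis of $l_2(\mathcal V_n)$ (its closed linear span is $l_2(\mathcal V_n)$). $[\mathcal A\xi]$ is the closed linear subspace generated by $\{A^n\xi\}_{n\ge0}$. *)

theory Defs
  imports "HOL-Analysis.Analysis"
begin

section \<open>Graphs and distance partitions\<close>

definition adj_rel :: "'v set set \<Rightarrow> ('v \<times> 'v) set" where
  "adj_rel E = {(x, y). {x, y} \<in> E}"

text \<open>Non-oriented, simple, connected, locally finite, with at least one edge.\<close>

definition simple_graph :: "'v set \<Rightarrow> 'v set set \<Rightarrow> bool" where
  "simple_graph V E \<longleftrightarrow>
     E \<noteq> {} \<and>
     (\<forall>e\<in>E. \<exists>x\<in>V. \<exists>y\<in>V. x \<noteq> y \<and> e = {x, y}) \<and>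
     (\<forall>x\<in>V. finite {y. {x, y} \<in> E}) \<and>
     (\<forall>x\<in>V. \<forall>y\<in>V. (x, y) \<in> (adj_rel E)\<^sup>*)"

definition graph_dist :: "'v set set \<Rightarrow> 'v \<Rightarrow> 'v \<Rightarrow> nat" where
  "graph_dist E x y = (LEAST n. (x, y) \<in> adj_rel E ^^ n)"

definition level :: "'v set set \<Rightarrow> 'v set \<Rightarrow> 'v \<Rightarrow> nat" where
  "level E V0 v = (INF v0\<in>V0. graph_dist E v v0)"

definition stratum :: "'v set \<Rightarrow> 'v set set \<Rightarrow> 'v set \<Rightarrow> nat \<Rightarrow> 'v set" where
  "stratum V E V0 n = {v \<in> V. level E V0 v = n}"


section \<open>The Hilbert spaces of square-summable functions\<close>

text \<open>Vectors are functions on the whole type; \<open>l2 S\<close> consists of those vanishing outside \<open>S\<close>,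
  so that \<open>l2 (stratum V E V0 n)\<close> is a subspace of \<open>l2 V\<close>.\<close>

definition l2 :: "'v set \<Rightarrow> ('v \<Rightarrow> complex) set" where
  "l2 S = {f. (\<forall>v. v \<notin> S \<longrightarrow> f v = 0) \<and> (\<lambda>v. (cmod (f v))\<^sup>2) summable_on UNIV}"

definition l2_inner :: "('v \<Rightarrow> complex) \<Rightarrow> ('v \<Rightarrow> complex) \<Rightarrow> complex" where
  "l2_inner f g = (\<Sum>\<^sub>\<infinity>v. cnj (f v) * g v)"

definition l2_norm :: "('v \<Rightarrow> complex) \<Rightarrow> real" where
  "l2_norm f = sqrt (\<Sum>\<^sub>\<infinity>v. (cmod (f v))\<^sup>2)"

definition lin_span :: "('v \<Rightarrow> complex) set \<Rightarrow> ('v \<Rightarrow> complex) set" where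
  "lin_span B = {f. \<exists>F c. finite F \<and> F \<subseteq> B \<and> f = (\<lambda>v. \<Sum>b\<in>F. c b * b v)}"

text \<open>The conjunct \<open>g \<in> l2 S\<close> matters because \<open>l2_norm\<close> is junk (zero) on functions that are not
  square-summable.\<close>

definition closed_span :: "'v set \<Rightarrow> ('v \<Rightarrow> complex) set \<Rightarrow> ('v \<Rightarrow> complex) set" where
  "closed_span S B =
     {f \<in> l2 S. \<forall>\<epsilon>>0. \<exists>g \<in> lin_span B. g \<in> l2 S \<and> l2_norm (\<lambda>v. f v - g v) < \<epsilon>}"

text \<open>Total subset of \<open>l2 S\<close>.\<close>

definition l2_basis :: "'v set \<Rightarrow> ('v \<Rightarrow> complex) set \<Rightarrow> bool" where
  "l2_basis S B \<longleftrightarrow> B \<subseteq> l2 S \<and> closed_span S B = l2 S"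

text \<open>Internal Hilbert sum: \<open>l2 S\<close> is the orthogonal direct sum of the closed subspaces \<open>M i\<close>,
  \<open>i \<in> I\<close>. That \<open>M i\<close> is a closed subspace is expressed as its being its own closed span.\<close>

definition orthogonal_direct_sum ::
    "'v set \<Rightarrow> 'i set \<Rightarrow> ('i \<Rightarrow> ('v \<Rightarrow> complex) set) \<Rightarrow> bool" where
  "orthogonal_direct_sum S I M \<longleftrightarrow>
     (\<forall>i\<in>I. closed_span S (M i) = M i) \<and>
     (\<forall>i\<in>I. \<forall>j\<in>I. i \<noteq> j \<longrightarrow> (\<forall>f\<in>M i. \<forall>g\<in>M j. l2_inner f g = 0)) \<and>
     closed_span S (\<Union>i\<in>I. M i) = l2 S"


section \<open>Quantum decomposition of the adjacency matrix\<close>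

text \<open>By local finiteness the matrices act on arbitrary functions. Each operator is written through
  the rows of its matrix; the action on \<open>\<delta> x\<close> (the columns) is recorded below.\<close>

definition adj_op :: "'v set set \<Rightarrow> ('v \<Rightarrow> complex) \<Rightarrow> 'v \<Rightarrow> complex" where
  "adj_op E f = (\<lambda>v. \<Sum>x | {x, v} \<in> E. f x)"

definition plus_op :: "'v set set \<Rightarrow> 'v set \<Rightarrow> ('v \<Rightarrow> complex) \<Rightarrow> 'v \<Rightarrow> complex" where
  "plus_op E V0 f = (\<lambda>v. \<Sum>x | {x, v} \<in> E \<and> level E V0 v = level E V0 x + 1. f x)"

definition zero_op :: "'v set set \<Rightarrow> 'v set \<Rightarrow> ('v \<Rightarrow> complex) \<Rightarrow> 'v \<Rightarrow> complex" where
  "zero_op E V0 f = (\<lambda>v. \<Sum>x | {x, v} \<in> E \<and> level E V0 v = level E V0 x. f x)"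

definition minus_op :: "'v set set \<Rightarrow> 'v set \<Rightarrow> ('v \<Rightarrow> complex) \<Rightarrow> 'v \<Rightarrow> complex" where
  "minus_op E V0 f = (\<lambda>v. \<Sum>x | {x, v} \<in> E \<and> level E V0 v + 1 = level E V0 x. f x)"

definition delta :: "'v \<Rightarrow> 'v \<Rightarrow> complex" where
  "delta x = (\<lambda>v. if v = x then 1 else 0)"

lemma edge_in_verts:
  assumes "simple_graph V E" "{x, y} \<in> E"
  shows "x \<in> V" "y \<in> V"
proof -
  have "\<exists>a\<in>V. \<exists>b\<in>V. a \<noteq> b \<and> {x, y} = {a, b}"
    using assms unfolding simple_graph_def by (elim conjE) (erule bspec)
  then show "x \<in> V" "y \<in> V" by (auto simp: doubleton_eq_iff)
qed

lemma finite_neighbours: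
  assumes "simple_graph V E"
  shows "finite {y. {x, y} \<in> E}" "finite {y. {y, x} \<in> E}"
proof -
  have "finite {y. {x, y} \<in> E}"
  proof (cases "x \<in> V")
    case True
    then show ?thesis using assms by (simp add: simple_graph_def)
  next
    case False
    have "{x, y} \<notin> E" for y
      using edge_in_verts(1)[OF assms] False by blast
    then show ?thesis by simp
  qed
  then show "finite {y. {x, y} \<in> E}" "finite {y. {y, x} \<in> E}"
    by (simp_all add: insert_commute)
qed

lemma quantum_decomposition_delta:
  assumes "simple_graph V E" "x \<in> stratum V E V0 n"
  shows "plus_op E V0 (delta x) =
           (\<lambda>v. \<Sum>y | {x, y} \<in> E \<and> y \<in> stratum V E V0 (n + 1). delta y v)"
    and "zero_op E V0 (delta x) =
           (\<lambda>v. \<Sum>y | {x, y} \<in> E \<and> y \<in> stratum V E V0 n. delta y v)"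
    and "minus_op E V0 (delta x) =
           (\<lambda>v. \<Sum>y | {x, y} \<in> E \<and> (\<exists>m. n = m + 1 \<and> y \<in> stratum V E V0 m). delta y v)"
proof -
  have V: "y \<in> V" if "{x, y} \<in> E" for y
    using edge_in_verts(2)[OF assms(1) that] .
  have lx: "level E V0 x = n"
    using assms(2) by (simp add: stratum_def)
  have key: "(\<Sum>u | {u, v} \<in> E \<and> P u v. delta x u) = (\<Sum>y | {x, y} \<in> E \<and> P x y. delta y v)"
    for P :: "'a \<Rightarrow> 'a \<Rightarrow> bool" and v
  proof -
    have f1: "finite {u. {u, v} \<in> E \<and> P u v}"
      by (rule finite_subset[OF _ finite_neighbours(2)[OF assms(1), of v]]) auto
    have f2: "finite {y. {x, y} \<in> E \<and> P x y}"
      by (rule finite_subset[OF _ finite_neighbours(1)[OF assms(1), of x]]) auto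
    show ?thesis
      unfolding delta_def using f1 f2 by (simp add: sum.delta sum.delta')
  qed
  have e1: "{y. {x, y} \<in> E \<and> y \<in> stratum V E V0 (n + 1)}
      = {y. {x, y} \<in> E \<and> level E V0 y = level E V0 x + 1}"
    using V lx by (auto simp: stratum_def)
  have e2: "{y. {x, y} \<in> E \<and> y \<in> stratum V E V0 n}
      = {y. {x, y} \<in> E \<and> level E V0 y = level E V0 x}"
    using V lx by (auto simp: stratum_def)
  have e3: "{y. {x, y} \<in> E \<and> (\<exists>m. n = m + 1 \<and> y \<in> stratum V E V0 m)}
      = {y. {x, y} \<in> E \<and> level E V0 y + 1 = level E V0 x}"
    using V lx by (auto simp: stratum_def)
  show "plus_op E V0 (delta x) =
           (\<lambda>v. \<Sum>y | {x, y} \<in> E \<and> y \<in> stratum V E V0 (n + 1). delta y v)"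
    unfolding plus_op_def e1
    using key[of _ "\<lambda>u v. level E V0 v = level E V0 u + 1"] by (intro ext) simp
  show "zero_op E V0 (delta x) =
           (\<lambda>v. \<Sum>y | {x, y} \<in> E \<and> y \<in> stratum V E V0 n. delta y v)"
    unfolding zero_op_def e2
    using key[of _ "\<lambda>u v. level E V0 v = level E V0 u"] by (intro ext) simp
  show "minus_op E V0 (delta x) =
           (\<lambda>v. \<Sum>y | {x, y} \<in> E \<and> (\<exists>m. n = m + 1 \<and> y \<in> stratum V E V0 m). delta y v)"
    unfolding minus_op_def e3
    using key[of _ "\<lambda>u v. level E V0 v + 1 = level E V0 u"] by (intro ext) simp
qed

lemma level_adjacent:
  assumes "simple_graph V E" "V0 \<subseteq> V" "V0 \<noteq> {}" "{x, y} \<in> E"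
  shows "level E V0 x \<le> level E V0 y + 1"
proof -
  have V: "x \<in> V" "y \<in> V"
    using edge_in_verts[OF assms(1,4)] .
  have "level E V0 y \<in> (\<lambda>v0. graph_dist E y v0) ` V0"
    unfolding level_def using assms(3) by (intro Inf_nat_def1) auto
  then obtain w where w: "w \<in> V0" "level E V0 y = graph_dist E y w" by auto
  have "(y, w) \<in> (adj_rel E)\<^sup>*"
    using assms(1,2) V w by (auto simp: simple_graph_def)
  then obtain n where "(y, w) \<in> adj_rel E ^^ n"
    using rtrancl_imp_relpow by blast
  then have "(y, w) \<in> adj_rel E ^^ graph_dist E y w"
    unfolding graph_dist_def by (rule LeastI)
  moreover have "(x, y) \<in> adj_rel E"
    using assms(4) by (simp add: adj_rel_def)
  ultimately have "(x, w) \<in> adj_rel E ^^ Suc (graph_dist E y w)"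
    by (meson relpow_Suc_I2)
  then have "graph_dist E x w \<le> Suc (graph_dist E y w)"
    unfolding graph_dist_def by (rule Least_le)
  moreover have "level E V0 x \<le> graph_dist E x w"
    unfolding level_def using w by (intro cINF_lower) auto
  ultimately show ?thesis using w by simp
qed

lemma quantum_decomposition:
  assumes "simple_graph V E" "V0 \<subseteq> V" "V0 \<noteq> {}"
  shows "adj_op E f v = plus_op E V0 f v + zero_op E V0 f v + minus_op E V0 f v"
proof -
  let ?P = "{x. {x, v} \<in> E \<and> level E V0 v = level E V0 x + 1}"
  let ?Z = "{x. {x, v} \<in> E \<and> level E V0 v = level E V0 x}"
  let ?M = "{x. {x, v} \<in> E \<and> level E V0 v + 1 = level E V0 x}"
  have fin: "finite ?P" "finite ?Z" "finite ?M"
    by (rule finite_subset[OF _ finite_neighbours(2)[OF assms(1), of v]]; auto)+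
  have "{x. {x, v} \<in> E} = ?P \<union> ?Z \<union> ?M"
  proof -
    have "level E V0 x \<le> level E V0 v + 1 \<and> level E V0 v \<le> level E V0 x + 1"
      if "{x, v} \<in> E" for x
      using level_adjacent[OF assms, of x v] level_adjacent[OF assms, of v x] that
      by (simp add: insert_commute)
    then show ?thesis by fastforce
  qed
  then have "adj_op E f v = sum f (?P \<union> ?Z \<union> ?M)"
    unfolding adj_op_def by (rule arg_cong)
  also have "\<dots> = sum f ?P + sum f ?Z + sum f ?M"
    using fin by (subst sum.union_disjoint; (subst sum.union_disjoint)?) auto
  finally show ?thesis
    by (simp add: plus_op_def zero_op_def minus_op_def)
qed

text \<open>When the degrees are unbounded the operators are unbounded on \<open>l2 V\<close>. As operators on \<open>l2 V\<close>
  they are the closures of their restrictions to the linear span of the \<open>\<delta> x\<close>, i.e. to the finitely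
  supported functions. Since norm convergence implies pointwise convergence and every matrix row is
  finite, the closure still acts by the matrix formula, so only its domain has to be specified.
  On the maximal domain, \<open>A\<^sup>+\<close> and \<open>A\<^sup>-\<close> need not be formally adjoint to each other when
  a stratum is infinite and the degrees are unbounded.\<close>

definition op_dom ::
    "'v set \<Rightarrow> (('v \<Rightarrow> complex) \<Rightarrow> 'v \<Rightarrow> complex) \<Rightarrow> ('v \<Rightarrow> complex) set" where
  "op_dom V T =
     {f \<in> l2 V. T f \<in> l2 V \<and>
        (\<exists>F :: nat \<Rightarrow> 'v \<Rightarrow> complex.
           (\<forall>k. F k \<in> l2 V \<and> finite {v. F k v \<noteq> 0}) \<and>
           (\<lambda>k. l2_norm (\<lambda>v. F k v - f v)) \<longlonglongrightarrow> 0 \<and>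
           (\<lambda>k. l2_norm (\<lambda>v. T (F k) v - T f v)) \<longlonglongrightarrow> 0)}"

text \<open>Domain of the operator sum \<open>A = A\<^sup>+ + A\<^sup>0 + A\<^sup>-\<close>.\<close>

definition adj_dom :: "'v set \<Rightarrow> 'v set set \<Rightarrow> 'v set \<Rightarrow> ('v \<Rightarrow> complex) set" where
  "adj_dom V E V0 =
     op_dom V (plus_op E V0) \<inter> op_dom V (zero_op E V0) \<inter> op_dom V (minus_op E V0)"


section \<open>J-vacuum vectors\<close>

definition vacuum_vector ::
    "'v set \<Rightarrow> 'v set set \<Rightarrow> 'v set \<Rightarrow> ('v \<Rightarrow> complex) \<Rightarrow> bool" where
  "vacuum_vector V E V0 \<xi> \<longleftrightarrow>
     \<xi> \<in> l2 V \<and> \<xi> \<noteq> (\<lambda>v. 0) \<and> \<xi> \<in> op_dom V (minus_op E V0) \<and> minus_op E V0 \<xi> = (\<lambda>v. 0)"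

definition J_vacuum_vector ::
    "'v set \<Rightarrow> 'v set set \<Rightarrow> 'v set \<Rightarrow> ('v \<Rightarrow> complex) \<Rightarrow> bool" where
  "J_vacuum_vector V E V0 \<xi> \<longleftrightarrow>
     vacuum_vector V E V0 \<xi> \<and>
     (\<exists>\<omega> \<alpha> :: nat \<Rightarrow> real. \<forall>n. let \<xi>n = (plus_op E V0 ^^ n) \<xi> in
        \<omega> n \<ge> 0 \<and>
        \<xi>n \<in> op_dom V (plus_op E V0) \<and>
        plus_op E V0 \<xi>n \<in> op_dom V (minus_op E V0) \<and>
        minus_op E V0 (plus_op E V0 \<xi>n) = (\<lambda>v. of_real (\<omega> n) * \<xi>n v) \<and>
        \<xi>n \<in> op_dom V (zero_op E V0) \<and>
        zero_op E V0 \<xi>n = (\<lambda>v. of_real (\<alpha> n) * \<xi>n v) \<and>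
        (\<xi>n = (\<lambda>v. 0) \<longrightarrow> \<omega> n = 0 \<and> \<alpha> n = 0))"

definition orthogonal_J_vacuum_set ::
    "'v set \<Rightarrow> 'v set set \<Rightarrow> 'v set \<Rightarrow> ('v \<Rightarrow> complex) set \<Rightarrow> bool" where
  "orthogonal_J_vacuum_set V E V0 \<Xi> \<longleftrightarrow>
     (\<forall>\<xi>\<in>\<Xi>. J_vacuum_vector V E V0 \<xi>) \<and> pairwise (\<lambda>\<xi> \<eta>. l2_inner \<xi> \<eta> = 0) \<Xi>"

definition distance_adapted ::
    "'v set \<Rightarrow> 'v set set \<Rightarrow> 'v set \<Rightarrow> ('v \<Rightarrow> complex) set \<Rightarrow> (nat \<Rightarrow> ('v \<Rightarrow> complex) set) \<Rightarrow> bool"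
  where
  "distance_adapted V E V0 \<Xi> \<Xi>n \<longleftrightarrow>
     \<Xi> = (\<Union>n. \<Xi>n n) \<and> (\<forall>n. \<Xi>n n \<subseteq> l2 (stratum V E V0 n))"

primrec generated_level ::
    "'v set set \<Rightarrow> 'v set \<Rightarrow> (nat \<Rightarrow> ('v \<Rightarrow> complex) set) \<Rightarrow> nat \<Rightarrow> ('v \<Rightarrow> complex) set" where
  "generated_level E V0 \<Xi>n 0 = \<Xi>n 0"
| "generated_level E V0 \<Xi>n (Suc n) =
     (plus_op E V0 ` generated_level E V0 \<Xi>n n \<union> \<Xi>n (Suc n)) - {\<lambda>v. 0}"

definition generating ::
    "'v set \<Rightarrow> 'v set set \<Rightarrow> 'v set \<Rightarrow> (nat \<Rightarrow> ('v \<Rightarrow> complex) set) \<Rightarrow> bool" where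
  "generating V E V0 \<Xi>n \<longleftrightarrow>
     (\<forall>n. l2_basis (stratum V E V0 n) (generated_level E V0 \<Xi>n n))"

definition cyclic_subspace ::
    "'v set \<Rightarrow> 'v set set \<Rightarrow> ('v \<Rightarrow> complex) \<Rightarrow> ('v \<Rightarrow> complex) set" where
  "cyclic_subspace V E \<xi> = closed_span V (range (\<lambda>n. (adj_op E ^^ n) \<xi>))"

end

theory Submission
  imports Defs
begin

text \<open>
  Each \<open>\<xi> \<in> \<Xi>\<close> generates a Jacobi chain \<open>\<xi>\<^sub>k = A\<^sup>+\<^sup>k \<xi>\<close> on which \<open>A\<close> acts as a tridiagonal matrix with
  subdiagonal entries 1, so \<open>A\<^sup>n \<xi>\<close> and \<open>\<xi>\<^sub>k\<close> have the same linear span. Since \<open>A\<^sup>+\<close> and \<open>A\<^sup>-\<close> are formally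
  adjoint, \<open>\<langle>\<xi>\<^sub>i\<^sub>+\<^sub>1, \<eta>\<^sub>j\<^sub>+\<^sub>1\<rangle>\<close> is a multiple of \<open>\<langle>\<xi>\<^sub>i, \<eta>\<^sub>j\<rangle>\<close>; descending until one index is 0, where
  \<open>A\<^sup>-\<close> annihilates a vacuum vector, shows that distinct chains are orthogonal. By the generating
  property the chains exhaust each \<open>l2 (stratum V E V0 n)\<close>, hence every point mass.
\<close>

section \<open>Square-summable functions\<close>

lemma l2_iff: "f \<in> l2 S \<longleftrightarrow> f \<in> l2 UNIV \<and> (\<forall>v. v \<notin> S \<longrightarrow> f v = 0)"
  by (auto simp: l2_def)

lemma l2_mono: "S \<subseteq> T \<Longrightarrow> l2 S \<subseteq> l2 T"
  by (auto simp: l2_def)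

lemma l2_norm_nonneg: "0 \<le> l2_norm f"
  by (simp add: l2_norm_def infsum_nonneg)

lemma l2_zero: "(\<lambda>v. 0) \<in> l2 S"
  by (simp add: l2_def)

lemma l2_norm_zero: "l2_norm (\<lambda>v. 0) = 0"
  by (simp add: l2_norm_def)

lemma l2_scale: "f \<in> l2 S \<Longrightarrow> (\<lambda>v. c * f v) \<in> l2 S"
  by (auto simp: l2_def norm_mult power_mult_distrib intro: summable_on_cmult_right)

lemma l2_norm_scale: "l2_norm (\<lambda>v. c * f v) = cmod c * l2_norm f"
  by (simp add: l2_norm_def norm_mult power_mult_distrib infsum_cmult_right' real_sqrt_mult)

lemma L2_set_le_l2_norm:
  assumes "f \<in> l2 S" "finite F"
  shows "L2_set (\<lambda>v. cmod (f v)) F \<le> l2_norm f"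
  using assms unfolding L2_set_def l2_norm_def l2_def
  by (auto intro!: real_sqrt_le_mono finite_sum_le_infsum)

text \<open>Sums of nonnegative terms converge once their finite partial sums are bounded. With
  \<open>L2_set_le_l2_norm\<close> this makes \<open>l2_norm\<close> the supremum of finite
  Euclidean norms, so finite inequalities pass to infinite sums.\<close>

lemma L2_set_bounded_imp_l2:
  assumes "\<And>F. finite F \<Longrightarrow> L2_set (\<lambda>v. cmod (f v)) F \<le> B"
  shows "f \<in> l2 UNIV" "l2_norm f \<le> B"
proof -
  have B: "0 \<le> B"
    using assms[of "{}"] by simp
  have sum: "(\<Sum>v\<in>F. (cmod (f v))\<^sup>2) \<le> B\<^sup>2" if "finite F" for F
    using assms[OF that] B unfolding L2_set_def by (simp add: real_sqrt_le_iff sqrt_le_D)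
  have summable: "(\<lambda>v. (cmod (f v))\<^sup>2) summable_on UNIV"
    by (rule nonneg_bdd_above_summable_on) (auto intro!: bdd_aboveI2[where M = "B\<^sup>2"] sum)
  then show "f \<in> l2 UNIV" by (simp add: l2_def)
  have "(\<Sum>\<^sub>\<infinity>v. (cmod (f v))\<^sup>2) \<le> B\<^sup>2"
    using summable sum by (intro infsum_le_finite_sums) auto
  then show "l2_norm f \<le> B"
    unfolding l2_norm_def using B by (simp add: real_le_lsqrt infsum_nonneg)
qed

text \<open>Finite Minkowski inequality with a bound independent of \<open>F\<close>, so that it
  yields both square-summability of the sum and the triangle inequality.\<close>

lemma L2_set_add_le:
  assumes "f \<in> l2 S" "g \<in> l2 T" "finite F"
  shows "L2_set (\<lambda>v. cmod (f v + g v)) F \<le> l2_norm f + l2_norm g"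
proof -
  have "L2_set (\<lambda>v. cmod (f v + g v)) F \<le> L2_set (\<lambda>v. cmod (f v) + cmod (g v)) F"
    by (intro L2_set_mono norm_triangle_ineq) simp
  also have "\<dots> \<le> L2_set (\<lambda>v. cmod (f v)) F + L2_set (\<lambda>v. cmod (g v)) F"
    by (rule L2_set_triangle_ineq)
  also have "\<dots> \<le> l2_norm f + l2_norm g"
    using L2_set_le_l2_norm[OF assms(1,3)] L2_set_le_l2_norm[OF assms(2,3)] by simp
  finally show ?thesis .
qed

lemma l2_add:
  assumes "f \<in> l2 S" "g \<in> l2 S"
  shows "(\<lambda>v. f v + g v) \<in> l2 S"
  using L2_set_bounded_imp_l2(1)[OF L2_set_add_le[OF assms]] assms by (auto simp: l2_def)

lemma l2_norm_add_le: "f \<in> l2 S \<Longrightarrow> g \<in> l2 T \<Longrightarrow> l2_norm (\<lambda>v. f v + g v) \<le> l2_norm f + l2_norm g"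
  using L2_set_bounded_imp_l2(2)[OF L2_set_add_le] .

lemma l2_diff: "f \<in> l2 S \<Longrightarrow> g \<in> l2 S \<Longrightarrow> (\<lambda>v. f v - g v) \<in> l2 S"
  using l2_add[of f S "\<lambda>v. (-1) * g v"] l2_scale[of g S "-1"] by simp

lemma l2_norm_diff_triangle:
  assumes "f \<in> l2 S" "g \<in> l2 S" "h \<in> l2 S"
  shows "l2_norm (\<lambda>v. f v - h v) \<le> l2_norm (\<lambda>v. f v - g v) + l2_norm (\<lambda>v. g v - h v)"
  using l2_norm_add_le[OF l2_diff[OF assms(1,2)] l2_diff[OF assms(2,3)]] by simp

lemma finite_support_l2:
  assumes "finite {v. f v \<noteq> 0}"
  shows "f \<in> l2 UNIV"
proof -
  have "(\<lambda>v. (cmod (f v))\<^sup>2) summable_on UNIV \<longleftrightarrow> (\<lambda>v. (cmod (f v))\<^sup>2) summable_on {v. f v \<noteq> 0}"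
    by (rule summable_on_cong_neutral) auto
  then show ?thesis using assms by (simp add: l2_def)
qed

text \<open>Cauchy-Schwarz on finite sets bounds the sums of absolute values uniformly; this gives
  absolute summability and the bound for the inner product.\<close>

lemma
  assumes "f \<in> l2 S" "g \<in> l2 T"
  shows summable_on_l2_inner: "(\<lambda>v. cnj (f v) * g v) summable_on UNIV"
    and norm_l2_inner_le: "cmod (l2_inner f g) \<le> l2_norm f * l2_norm g"
proof -
  have fin: "(\<Sum>v\<in>F. cmod (cnj (f v) * g v)) \<le> l2_norm f * l2_norm g" if "finite F" for F
  proof -
    have "(\<Sum>v\<in>F. cmod (cnj (f v) * g v))
        \<le> L2_set (\<lambda>v. cmod (f v)) F * L2_set (\<lambda>v. cmod (g v)) F"
      using L2_set_mult_ineq[of "\<lambda>v. cmod (f v)" "\<lambda>v. cmod (g v)" F] by (simp add: norm_mult)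
    also have "\<dots> \<le> l2_norm f * l2_norm g"
      using L2_set_le_l2_norm[OF assms(1) that] L2_set_le_l2_norm[OF assms(2) that]
      by (intro mult_mono l2_norm_nonneg) simp_all
    finally show ?thesis .
  qed
  have abs: "(\<lambda>v. cmod (cnj (f v) * g v)) summable_on UNIV"
    by (rule nonneg_bdd_above_summable_on)
      (auto intro!: bdd_aboveI2[where M = "l2_norm f * l2_norm g"] fin simp del: norm_mult)
  then show "(\<lambda>v. cnj (f v) * g v) summable_on UNIV"
    by (rule abs_summable_summable)
  have "cmod (l2_inner f g) \<le> (\<Sum>\<^sub>\<infinity>v. cmod (cnj (f v) * g v))"
    unfolding l2_inner_def by (rule norm_infsum_bound[OF abs])
  also have "\<dots> \<le> l2_norm f * l2_norm g"
    using abs fin by (intro infsum_le_finite_sums) auto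
  finally show "cmod (l2_inner f g) \<le> l2_norm f * l2_norm g" .
qed

text \<open>Conjugation commutes with \<open>infsum\<close> even without summability. Linearity and
  continuity can then be developed in the second argument alone.\<close>

lemma l2_inner_commute: "l2_inner g f = cnj (l2_inner f g)"
  unfolding l2_inner_def by (subst infsum_cnj[symmetric]) (simp add: mult.commute)

lemma l2_inner_add_right:
  assumes "f \<in> l2 S" "g \<in> l2 T" "h \<in> l2 T"
  shows "l2_inner f (\<lambda>v. g v + h v) = l2_inner f g + l2_inner f h"
  unfolding l2_inner_def distrib_left
  by (intro infsum_add summable_on_l2_inner[OF assms(1,2)] summable_on_l2_inner[OF assms(1,3)])

lemma l2_inner_scale_right: "l2_inner f (\<lambda>v. c * g v) = c * l2_inner f g"
  unfolding l2_inner_def by (simp add: mult.left_commute infsum_cmult_right')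

lemma l2_inner_zero_right: "l2_inner f (\<lambda>v. 0) = 0"
  by (simp add: l2_inner_def)

lemma l2_inner_diff_right:
  assumes "f \<in> l2 S" "g \<in> l2 T" "h \<in> l2 T"
  shows "l2_inner f (\<lambda>v. g v - h v) = l2_inner f g - l2_inner f h"
  using l2_inner_add_right[OF assms(1,2) l2_scale[OF assms(3), of "-1"]]
    l2_inner_scale_right[of f "-1" h] by simp

text \<open>Cauchy-Schwarz bounds the error by \<open>l2_norm f\<close> times the norm distance.
  Separate carriers allow the sequence to leave the carrier of \<open>f\<close>.\<close>

lemma tendsto_l2_inner_right:
  assumes "f \<in> l2 S" "\<And>k. G k \<in> l2 T" "g \<in> l2 T"
    and "(\<lambda>k. l2_norm (\<lambda>v. G k v - g v)) \<longlonglongrightarrow> 0"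
  shows "(\<lambda>k. l2_inner f (G k)) \<longlonglongrightarrow> l2_inner f g"
proof -
  have "(\<lambda>k. l2_inner f (G k) - l2_inner f g) \<longlonglongrightarrow> 0"
  proof (rule Lim_null_comparison)
    show "\<forall>\<^sub>F k in sequentially. cmod (l2_inner f (G k) - l2_inner f g)
        \<le> l2_norm f * l2_norm (\<lambda>v. G k v - g v)"
      using norm_l2_inner_le[OF assms(1) l2_diff[OF assms(2,3)]]
      by (simp add: l2_inner_diff_right[OF assms(1,2,3)])
    show "(\<lambda>k. l2_norm f * l2_norm (\<lambda>v. G k v - g v)) \<longlonglongrightarrow> 0"
      using tendsto_mult_left[OF assms(4)] by simp
  qed
  then show ?thesis by (simp add: LIM_zero_iff)
qed

section \<open>Closed subspaces\<close>

text \<open>Square-summability is not demanded, so that preimages under matrices acting on arbitrary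
  functions qualify too.\<close>

definition linear_subspace :: "('v \<Rightarrow> complex) set \<Rightarrow> bool" where
  "linear_subspace M \<longleftrightarrow> (\<lambda>v. 0) \<in> M \<and>
     (\<forall>f\<in>M. \<forall>g\<in>M. (\<lambda>v. f v + g v) \<in> M) \<and> (\<forall>c. \<forall>f\<in>M. (\<lambda>v. c * f v) \<in> M)"

lemma linear_subspaceD:
  assumes "linear_subspace M"
  shows "(\<lambda>v. 0) \<in> M"
    and "f \<in> M \<Longrightarrow> g \<in> M \<Longrightarrow> (\<lambda>v. f v + g v) \<in> M"
    and "f \<in> M \<Longrightarrow> (\<lambda>v. c * f v) \<in> M"
  using assms by (auto simp: linear_subspace_def)

lemma linear_subspace_diff:
  assumes "linear_subspace M" "f \<in> M" "g \<in> M"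
  shows "(\<lambda>v. f v - g v) \<in> M"
  using linear_subspaceD(2)[OF assms(1,2) linear_subspaceD(3)[OF assms(1,3), of "-1"]] by simp

lemma linear_subspace_sum:
  assumes "linear_subspace M" "\<And>i. i \<in> F \<Longrightarrow> h i \<in> M"
  shows "(\<lambda>v. \<Sum>i\<in>F. h i v) \<in> M"
  using assms(2)
proof (induction F rule: infinite_finite_induct)
  case (insert x F)
  then show ?case
    using linear_subspaceD(2)[OF assms(1), of "h x" "\<lambda>v. \<Sum>i\<in>F. h i v"] by simp
qed (simp_all add: linear_subspaceD(1)[OF assms(1)])

section \<open>Linear spans\<close>

lemma lin_span_superset: "B \<subseteq> lin_span B"
proof
  fix b assume "b \<in> B"
  then have "finite {b} \<and> {b} \<subseteq> B \<and> b = (\<lambda>v. \<Sum>b\<in>{b}. 1 * b v)" by simp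
  then show "b \<in> lin_span B"
    unfolding lin_span_def by (intro CollectI exI[of _ "{b}"] exI[of _ "\<lambda>_. 1"])
qed

lemma lin_span_minimal: "linear_subspace M \<Longrightarrow> B \<subseteq> M \<Longrightarrow> lin_span B \<subseteq> M"
  unfolding lin_span_def by (auto intro!: linear_subspace_sum linear_subspaceD(3))

lemma linear_subspace_lin_span: "linear_subspace (lin_span B)"
  unfolding linear_subspace_def
proof (intro conjI ballI allI)
  show "(\<lambda>v. 0) \<in> lin_span B"
    unfolding lin_span_def by (intro CollectI exI[of _ "{}"]) simp
next
  fix f g assume "f \<in> lin_span B" "g \<in> lin_span B"
  then obtain F c G d where F: "finite F" "F \<subseteq> B" "f = (\<lambda>v. \<Sum>b\<in>F. c b * b v)"
    and G: "finite G" "G \<subseteq> B" "g = (\<lambda>v. \<Sum>b\<in>G. d b * b v)"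
    unfolding lin_span_def by blast
  \<comment> \<open>Both combinations are rewritten over \<open>F \<union> G\<close>, with
    coefficients extended by zero, so that they add termwise.\<close>
  define e where "e b = (if b \<in> F then c b else 0) + (if b \<in> G then d b else 0)" for b
  have "(\<Sum>b\<in>F. c b * b v) = (\<Sum>b\<in>F \<union> G. (if b \<in> F then c b else 0) * b v)"
    and "(\<Sum>b\<in>G. d b * b v) = (\<Sum>b\<in>F \<union> G. (if b \<in> G then d b else 0) * b v)" for v
    using F(1) G(1) by (intro sum.mono_neutral_cong_left; auto)+
  then have "(\<lambda>v. f v + g v) = (\<lambda>v. \<Sum>b\<in>F \<union> G. e b * b v)"
    by (simp add: F G e_def distrib_right sum.distrib)
  then show "(\<lambda>v. f v + g v) \<in> lin_span B"
    unfolding lin_span_def using F G by (intro CollectI exI[of _ "F \<union> G"] exI[of _ e]) auto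
next
  fix a f assume "f \<in> lin_span B"
  then obtain F c where F: "finite F" "F \<subseteq> B" "f = (\<lambda>v. \<Sum>b\<in>F. c b * b v)"
    unfolding lin_span_def by blast
  then show "(\<lambda>v. a * f v) \<in> lin_span B"
    unfolding lin_span_def
    by (intro CollectI exI[of _ F] exI[of _ "\<lambda>b. a * c b"]) (auto simp: sum_distrib_left mult.assoc)
qed

text \<open>Approximants come from \<open>M\<close>, which lies in \<open>l2 S\<close>, so the norms
  of the differences are never junk values.\<close>

definition closed_subspace :: "'v set \<Rightarrow> ('v \<Rightarrow> complex) set \<Rightarrow> bool" where
  "closed_subspace S M \<longleftrightarrow> linear_subspace M \<and> M \<subseteq> l2 S \<and>
     (\<forall>f\<in>l2 S. (\<forall>\<epsilon>>0. \<exists>g\<in>M. l2_norm (\<lambda>v. f v - g v) < \<epsilon>) \<longrightarrow> f \<in> M)"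

lemma closed_subspaceI:
  assumes "linear_subspace M" "M \<subseteq> l2 S"
    and "\<And>f. f \<in> l2 S \<Longrightarrow> (\<And>\<epsilon>. \<epsilon> > 0 \<Longrightarrow> \<exists>g\<in>M. l2_norm (\<lambda>v. f v - g v) < \<epsilon>) \<Longrightarrow> f \<in> M"
  shows "closed_subspace S M"
  using assms unfolding closed_subspace_def by blast

section \<open>Closed spans\<close>

lemma closed_span_subset_l2: "closed_span S B \<subseteq> l2 S"
  by (auto simp: closed_span_def)

lemma closed_span_superset: "B \<inter> l2 S \<subseteq> closed_span S B"
proof
  fix f assume "f \<in> B \<inter> l2 S"
  then have "f \<in> lin_span B" "f \<in> l2 S" "l2_norm (\<lambda>v. f v - f v) = 0"
    using lin_span_superset by (auto simp: l2_norm_zero)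
  then show "f \<in> closed_span S B" unfolding closed_span_def by force
qed

lemma closed_span_mono_carrier: "S \<subseteq> T \<Longrightarrow> closed_span S B \<subseteq> closed_span T B"
  unfolding closed_span_def using l2_mono[of S T] by blast

text \<open>Serves as an induction principle: a property that cuts out a closed subspace need only
  be checked on generators.\<close>

lemma closed_span_minimal:
  assumes "closed_subspace S M" "B \<subseteq> M"
  shows "closed_span S B \<subseteq> M"
proof -
  have "lin_span B \<subseteq> M"
    using assms lin_span_minimal by (auto simp: closed_subspace_def)
  then show ?thesis
    using assms(1) unfolding closed_span_def closed_subspace_def by blast
qed

text \<open>Sums and multiples of approximants approximate sums and multiples; closedness follows by
  approximating twice, each time within half of \<epsilon>.\<close>

lemma closed_subspace_closed_span: "closed_subspace S (closed_span S B)"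
proof (rule closed_subspaceI)
  note L = linear_subspaceD[OF linear_subspace_lin_span[of B]]
  show "linear_subspace (closed_span S B)"
    unfolding linear_subspace_def
  proof (intro conjI ballI allI)
    show "(\<lambda>v. 0) \<in> closed_span S B"
      unfolding closed_span_def
      by (intro CollectI conjI allI impI l2_zero bexI[OF _ L(1)]) (simp add: l2_norm_zero)
  next
    fix f g assume fg: "f \<in> closed_span S B" "g \<in> closed_span S B"
    show "(\<lambda>v. f v + g v) \<in> closed_span S B"
      unfolding closed_span_def
    proof (intro CollectI conjI allI impI)
      show "(\<lambda>v. f v + g v) \<in> l2 S"
        using fg closed_span_subset_l2 by (intro l2_add) auto
      fix \<epsilon> :: real assume "\<epsilon> > 0"
      then have "\<epsilon> / 2 > 0" by simp
      then obtain f' g' where f': "f' \<in> lin_span B" "f' \<in> l2 S" "l2_norm (\<lambda>v. f v - f' v) < \<epsilon> / 2"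
        and g': "g' \<in> lin_span B" "g' \<in> l2 S" "l2_norm (\<lambda>v. g v - g' v) < \<epsilon> / 2"
        using fg unfolding closed_span_def by blast
      have "l2_norm (\<lambda>v. (f v - f' v) + (g v - g' v)) < \<epsilon>"
        using l2_norm_add_le[of "\<lambda>v. f v - f' v" S "\<lambda>v. g v - g' v" S] f' g' fg
          closed_span_subset_l2[of S B] by (force intro: l2_diff)
      then have "l2_norm (\<lambda>v. (f v + g v) - (f' v + g' v)) < \<epsilon>"
        by (simp add: algebra_simps)
      then show "\<exists>h\<in>lin_span B. h \<in> l2 S \<and> l2_norm (\<lambda>v. (f v + g v) - h v) < \<epsilon>"
        using L(2)[OF f'(1) g'(1)] l2_add[OF f'(2) g'(2)] by blast
    qed
  next
    fix c f assume f: "f \<in> closed_span S B"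
    show "(\<lambda>v. c * f v) \<in> closed_span S B"
      unfolding closed_span_def
    proof (intro CollectI conjI allI impI)
      show "(\<lambda>v. c * f v) \<in> l2 S"
        using f closed_span_subset_l2 by (intro l2_scale) auto
      fix \<epsilon> :: real assume \<epsilon>: "\<epsilon> > 0"
      \<comment> \<open>Adding 1 keeps the divisor positive when \<open>c\<close> is 0.\<close>
      define \<delta> where "\<delta> = \<epsilon> / (cmod c + 1)"
      have pos: "cmod c + 1 > 0" by (smt (verit) norm_ge_zero)
      then have "\<delta> > 0" using \<epsilon> by (simp add: \<delta>_def)
      then obtain f' where f': "f' \<in> lin_span B" "f' \<in> l2 S" "l2_norm (\<lambda>v. f v - f' v) < \<delta>"
        using f unfolding closed_span_def by blast
      have "l2_norm (\<lambda>v. c * f v - c * f' v) = cmod c * l2_norm (\<lambda>v. f v - f' v)"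
        using l2_norm_scale[of c "\<lambda>v. f v - f' v"] by (simp add: algebra_simps)
      also have "\<dots> \<le> cmod c * \<delta>"
        using f'(3) by (intro mult_left_mono) auto
      also have "\<dots> < (cmod c + 1) * \<delta>"
        using \<open>\<delta> > 0\<close> by (simp add: distrib_right)
      also have "\<dots> = \<epsilon>" using pos by (simp add: \<delta>_def)
      finally show "\<exists>h\<in>lin_span B. h \<in> l2 S \<and> l2_norm (\<lambda>v. c * f v - h v) < \<epsilon>"
        using L(3)[OF f'(1), of c] l2_scale[OF f'(2), of c] by blast
    qed
  qed
  show "closed_span S B \<subseteq> l2 S" by (rule closed_span_subset_l2)
  fix f assume f: "f \<in> l2 S"
    and approx: "\<And>\<epsilon>. \<epsilon> > 0 \<Longrightarrow> \<exists>g\<in>closed_span S B. l2_norm (\<lambda>v. f v - g v) < \<epsilon>"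
  show "f \<in> closed_span S B"
    unfolding closed_span_def
  proof (intro CollectI conjI allI impI f)
    fix \<epsilon> :: real assume "\<epsilon> > 0"
    then have half: "\<epsilon> / 2 > 0" by simp
    obtain g where g: "g \<in> closed_span S B" "l2_norm (\<lambda>v. f v - g v) < \<epsilon> / 2"
      using approx[OF half] by blast
    then obtain h where h: "h \<in> lin_span B" "h \<in> l2 S" "l2_norm (\<lambda>v. g v - h v) < \<epsilon> / 2"
      using half unfolding closed_span_def by blast
    have "l2_norm (\<lambda>v. f v - h v) < \<epsilon>"
      using l2_norm_diff_triangle[OF f _ h(2), of g] g h closed_span_subset_l2[of S B] by force
    then show "\<exists>h\<in>lin_span B. h \<in> l2 S \<and> l2_norm (\<lambda>v. f v - h v) < \<epsilon>"
      using h by blast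
  qed
qed

lemma closed_span_idem: "closed_span S (closed_span S B) = closed_span S B"
proof
  show "closed_span S (closed_span S B) \<subseteq> closed_span S B"
    by (rule closed_span_minimal[OF closed_subspace_closed_span]) simp
  show "closed_span S B \<subseteq> closed_span S (closed_span S B)"
    using closed_span_superset[of "closed_span S B" S] closed_span_subset_l2[of S B] by blast
qed

text \<open>Each condition is linear in \<open>g\<close> and survives limits because Cauchy-Schwarz
  makes the inner product continuous.\<close>

lemma closed_subspace_orthogonal_complement:
  assumes "B \<subseteq> l2 S"
  shows "closed_subspace S {g \<in> l2 S. \<forall>f\<in>B. l2_inner f g = 0}"
proof (rule closed_subspaceI)
  show "linear_subspace {g \<in> l2 S. \<forall>f\<in>B. l2_inner f g = 0}"
    unfolding linear_subspace_def
  proof (intro conjI ballI allI)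
    fix g h assume "g \<in> {g \<in> l2 S. \<forall>f\<in>B. l2_inner f g = 0}" "h \<in> {g \<in> l2 S. \<forall>f\<in>B. l2_inner f g = 0}"
    then show "(\<lambda>v. g v + h v) \<in> {g \<in> l2 S. \<forall>f\<in>B. l2_inner f g = 0}"
      using assms by (auto simp: l2_add subset_iff l2_inner_add_right[where S = S and T = S])
  qed (auto simp: l2_zero l2_scale l2_inner_zero_right l2_inner_scale_right)
next
  fix g assume g: "g \<in> l2 S" and approx:
    "\<And>\<epsilon>. \<epsilon> > 0 \<Longrightarrow> \<exists>h\<in>{g \<in> l2 S. \<forall>f\<in>B. l2_inner f g = 0}. l2_norm (\<lambda>v. g v - h v) < \<epsilon>"
  have "l2_inner f g = 0" if "f \<in> B" for f
  proof -
    have f: "f \<in> l2 S" using that assms by auto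
    have "cmod (l2_inner f g) \<le> 0 + \<epsilon>" if "\<epsilon> > 0" for \<epsilon>
    proof -
      define \<delta> where "\<delta> = \<epsilon> / (l2_norm f + 1)"
      have pos: "l2_norm f + 1 > 0" using l2_norm_nonneg[of f] by linarith
      then have "\<delta> > 0" using that by (simp add: \<delta>_def)
      then obtain h where h: "h \<in> l2 S" "l2_inner f h = 0" "l2_norm (\<lambda>v. g v - h v) < \<delta>"
        using approx[of \<delta>] \<open>f \<in> B\<close> by blast
      \<comment> \<open>Subtracting an approximant orthogonal to \<open>f\<close> leaves the inner
        product unchanged and makes the second argument small.\<close>
      have "cmod (l2_inner f g) = cmod (l2_inner f (\<lambda>v. g v - h v))"
        using h(2) l2_inner_diff_right[OF f g h(1)] by simp
      also have "\<dots> \<le> l2_norm f * l2_norm (\<lambda>v. g v - h v)"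
        by (rule norm_l2_inner_le[OF f l2_diff[OF g h(1)]])
      also have "\<dots> \<le> (l2_norm f + 1) * \<delta>"
        using h(3) l2_norm_nonneg by (intro mult_mono) (auto intro: add_nonneg_nonneg)
      also have "\<dots> = \<epsilon>" using pos by (simp add: \<delta>_def)
      finally show ?thesis by simp
    qed
    then have "cmod (l2_inner f g) \<le> 0" by (rule field_le_epsilon)
    then show ?thesis by simp
  qed
  then show "g \<in> {g \<in> l2 S. \<forall>f\<in>B. l2_inner f g = 0}" using g by blast
qed blast

text \<open>The orthogonal complement of \<open>B\<close> absorbs the closed span of
  \<open>C\<close>. Conjugate symmetry then exchanges the arguments, and the same principle absorbs
  the closed span of \<open>B\<close>.\<close>

lemma closed_span_orthogonal:
  assumes "B \<subseteq> l2 S" "C \<subseteq> l2 S" "\<And>b c. b \<in> B \<Longrightarrow> c \<in> C \<Longrightarrow> l2_inner b c = 0"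
    and "f \<in> closed_span S B" "g \<in> closed_span S C"
  shows "l2_inner f g = 0"
proof -
  have 1: "closed_span S C \<subseteq> {g \<in> l2 S. \<forall>b\<in>B. l2_inner b g = 0}"
    using assms(2,3)
    by (intro closed_span_minimal[OF closed_subspace_orthogonal_complement[OF assms(1)]]) auto
  have "closed_span S B \<subseteq> {f \<in> l2 S. \<forall>c\<in>closed_span S C. l2_inner c f = 0}"
  proof (intro closed_span_minimal[OF closed_subspace_orthogonal_complement[OF closed_span_subset_l2]]
      subsetI CollectI conjI ballI)
    fix b c assume "b \<in> B" "c \<in> closed_span S C"
    then have "l2_inner b c = 0" using 1 by auto
    then show "l2_inner c b = 0" by (simp add: l2_inner_commute[of c b])
  qed (use assms(1) in auto)
  then have "l2_inner g f = 0" using assms(4,5) by auto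
  then show ?thesis by (simp add: l2_inner_commute[of f g])
qed

section \<open>Totality of the point masses\<close>

lemma delta_l2: "x \<in> S \<Longrightarrow> delta x \<in> l2 S"
  using finite_support_l2[of "delta x"] by (subst l2_iff) (auto simp: delta_def)

text \<open>Truncations of a square-summable function to finite sets are combinations of point
  masses, and the squared error is a tail of a convergent sum.\<close>

lemma closed_subspace_deltas:
  assumes "closed_subspace S M" "\<And>x. x \<in> S \<Longrightarrow> delta x \<in> M"
  shows "M = l2 S"
proof
  show "M \<subseteq> l2 S" using assms(1) by (simp add: closed_subspace_def)
  have lin: "linear_subspace M" using assms(1) by (simp add: closed_subspace_def)
  show "l2 S \<subseteq> M"
  proof
    fix f assume f: "f \<in> l2 S"
    then have summable: "(\<lambda>v. (cmod (f v))\<^sup>2) summable_on UNIV" by (simp add: l2_def)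
    have "\<exists>g\<in>M. l2_norm (\<lambda>v. f v - g v) < \<epsilon>" if "\<epsilon> > 0" for \<epsilon>
    proof -
      have "((\<lambda>v. (cmod (f v))\<^sup>2) has_sum (\<Sum>\<^sub>\<infinity>v. (cmod (f v))\<^sup>2)) UNIV"
        using summable by simp
      then have "\<forall>\<^sub>F F in finite_subsets_at_top UNIV.
          dist (\<Sum>v\<in>F. (cmod (f v))\<^sup>2) (\<Sum>\<^sub>\<infinity>v. (cmod (f v))\<^sup>2) < \<epsilon>\<^sup>2"
        using that unfolding has_sum_def by (intro tendstoD) auto
      then obtain F where F: "finite F"
        "dist (\<Sum>v\<in>F. (cmod (f v))\<^sup>2) (\<Sum>\<^sub>\<infinity>v. (cmod (f v))\<^sup>2) < \<epsilon>\<^sup>2"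
        unfolding eventually_finite_subsets_at_top by blast
      define g where "g = (\<lambda>v. \<Sum>x\<in>F. f x * delta x v)"
      have g: "g v = (if v \<in> F then f v else 0)" for v
        using F(1) by (simp add: g_def delta_def if_distrib cong: if_cong)
      have "g \<in> M"
        unfolding g_def
      proof (rule linear_subspace_sum[OF lin])
        fix x
        show "(\<lambda>v. f x * delta x v) \<in> M"
        \<comment> \<open>\<open>F\<close> is a finite set in the whole type; at points outside
          \<open>S\<close> the coefficient of the point mass is 0.\<close>
        proof (cases "x \<in> S")
          case False
          then have "f x = 0" using f by (simp add: l2_def)
          then show ?thesis using linear_subspaceD(1)[OF lin] by simp
        qed (use linear_subspaceD(3)[OF lin assms(2)] in auto)
      qed
      have "(\<Sum>\<^sub>\<infinity>v. (cmod (f v - g v))\<^sup>2) = (\<Sum>\<^sub>\<infinity>v\<in>UNIV - F. (cmod (f v))\<^sup>2)"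
        by (rule infsum_cong_neutral) (auto simp: g)
      also have "\<dots> = (\<Sum>\<^sub>\<infinity>v. (cmod (f v))\<^sup>2) - (\<Sum>v\<in>F. (cmod (f v))\<^sup>2)"
        using F(1) summable by (subst infsum_Diff) auto
      also have "\<dots> < \<epsilon>\<^sup>2"
        using F(2) by (simp add: dist_real_def)
      finally have "l2_norm (\<lambda>v. f v - g v) < \<epsilon>"
        unfolding l2_norm_def using that by (intro real_less_lsqrt) (auto intro: infsum_nonneg)
      then show ?thesis using \<open>g \<in> M\<close> by blast
    qed
    then show "f \<in> M" using assms(1) f unfolding closed_subspace_def by blast
  qed
qed

section \<open>Matrices with finite rows and columns\<close>

text \<open>The 0/1 matrix whose entry in column \<open>x\<close> and row \<open>v\<close> is 1 iff
  \<open>R x v\<close>; all operators of the graph have this form. An infinite row sums to 0, so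
  linearity holds for every \<open>R\<close>.\<close>

definition row_op :: "('v \<Rightarrow> 'v \<Rightarrow> bool) \<Rightarrow> ('v \<Rightarrow> complex) \<Rightarrow> 'v \<Rightarrow> complex" where
  "row_op R f = (\<lambda>v. \<Sum>x | R x v. f x)"

lemma row_op_add: "row_op R (\<lambda>v. f v + g v) = (\<lambda>v. row_op R f v + row_op R g v)"
  by (simp add: row_op_def sum.distrib)

lemma row_op_scale: "row_op R (\<lambda>v. c * f v) = (\<lambda>v. c * row_op R f v)"
  by (simp add: row_op_def sum_distrib_left)

lemma row_op_zero: "row_op R (\<lambda>v. 0) = (\<lambda>v. 0)"
  by (simp add: row_op_def)

text \<open>Reduces invariance of a linear span under a matrix to a check on generators.\<close>

lemma linear_subspace_row_op_vimage:
  "linear_subspace M \<Longrightarrow> linear_subspace {f. row_op R f \<in> M}"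
  by (simp add: linear_subspace_def row_op_add row_op_scale row_op_zero)

lemma finite_support_row_op:
  assumes "\<And>x. finite {v. R x v}" "finite {x. f x \<noteq> 0}"
  shows "finite {v. row_op R f v \<noteq> 0}"
proof (rule finite_subset)
  show "{v. row_op R f v \<noteq> 0} \<subseteq> (\<Union>x\<in>{x. f x \<noteq> 0}. {v. R x v})"
  proof
    fix v assume "v \<in> {v. row_op R f v \<noteq> 0}"
    then have "(\<Sum>x | R x v. f x) \<noteq> 0" by (simp add: row_op_def)
    then obtain x where "R x v" "f x \<noteq> 0" by (meson mem_Collect_eq sum.not_neutral_contains_not_neutral)
    then show "v \<in> (\<Union>x\<in>{x. f x \<noteq> 0}. {v. R x v})" by blast
  qed
qed (use assms in auto)

text \<open>The transpose is the adjoint because the entries are real. Finite support of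
  \<open>f\<close> turns both sides into finite double sums, so \<open>g\<close> may be
  arbitrary.\<close>

lemma l2_inner_row_op_finite_support:
  assumes R: "\<And>x. finite {v. R x v}" "\<And>v. finite {x. R x v}" and f: "finite {x. f x \<noteq> 0}"
  shows "l2_inner (row_op R f) g = l2_inner f (row_op (\<lambda>x v. R v x) g)"
proof -
  define X where "X = {x. f x \<noteq> 0}"
  \<comment> \<open>The union of the finite columns over the support of \<open>f\<close>, hence a
    finite set containing the support of the image.\<close>
  define Y where "Y = (\<Union>x\<in>X. {v. R x v})"
  have X: "finite X" and Y: "finite Y"
    using R(1) f by (auto simp: X_def Y_def)
  have row: "row_op R f v = (\<Sum>x | x \<in> X \<and> R x v. f x)" for v
    unfolding row_op_def by (rule sum.mono_neutral_right) (auto simp: X_def R(2))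
  have rowY: "row_op R f v = 0" if "v \<notin> Y" for v
  proof -
    have "{x. x \<in> X \<and> R x v} = {}" using that by (auto simp: Y_def)
    then show ?thesis by (simp only: row sum.empty)
  qed
  have "l2_inner (row_op R f) g = (\<Sum>\<^sub>\<infinity>v\<in>Y. cnj (row_op R f v) * g v)"
    unfolding l2_inner_def by (rule infsum_cong_neutral) (auto simp: rowY)
  also have "\<dots> = (\<Sum>v\<in>Y. \<Sum>x | x \<in> X \<and> R x v. cnj (f x) * g v)"
    using Y by (simp add: row sum_distrib_right)
  also have "\<dots> = (\<Sum>x\<in>X. \<Sum>v | v \<in> Y \<and> R x v. cnj (f x) * g v)"
    by (rule sum.swap_restrict[OF Y X])
  also have "\<dots> = (\<Sum>x\<in>X. cnj (f x) * row_op (\<lambda>x v. R v x) g x)"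
  proof (rule sum.cong[OF refl])
    fix x assume "x \<in> X"
    then have "{v. v \<in> Y \<and> R x v} = {v. R x v}" by (auto simp: Y_def)
    then show "(\<Sum>v | v \<in> Y \<and> R x v. cnj (f x) * g v) = cnj (f x) * row_op (\<lambda>x v. R v x) g x"
      by (simp add: row_op_def sum_distrib_left)
  qed
  also have "\<dots> = (\<Sum>\<^sub>\<infinity>x\<in>X. cnj (f x) * row_op (\<lambda>x v. R v x) g x)"
    using X by simp
  also have "\<dots> = l2_inner f (row_op (\<lambda>x v. R v x) g)"
    unfolding l2_inner_def by (rule infsum_cong_neutral) (auto simp: X_def)
  finally show ?thesis .
qed

section \<open>Closures of matrix operators: adjoints and domains\<close>

lemma op_domD: "f \<in> op_dom V T \<Longrightarrow> f \<in> l2 V" "f \<in> op_dom V T \<Longrightarrow> T f \<in> l2 V"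
  by (auto simp: op_dom_def)

text \<open>\<open>f\<close> is approximated in graph norm by finitely supported vectors, for which
  adjointness is known, and both sides converge. For \<open>g\<close> the maximal domain of the
  transpose is enough.\<close>

lemma l2_inner_row_op:
  assumes R: "\<And>x. finite {v. R x v}" "\<And>v. finite {x. R x v}"
    and f: "f \<in> op_dom V (row_op R)" and g: "g \<in> l2 V" "row_op (\<lambda>x v. R v x) g \<in> l2 V"
  shows "l2_inner g (row_op R f) = l2_inner (row_op (\<lambda>x v. R v x) g) f"
proof -
  obtain F where F: "\<And>k. F k \<in> l2 V" "\<And>k. finite {v. F k v \<noteq> 0}"
    "(\<lambda>k. l2_norm (\<lambda>v. F k v - f v)) \<longlonglongrightarrow> 0"
    "(\<lambda>k. l2_norm (\<lambda>v. row_op R (F k) v - row_op R f v)) \<longlonglongrightarrow> 0"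
    using f unfolding op_dom_def by blast
  \<comment> \<open>\<open>R\<close> may lead out of \<open>V\<close>, so these images are known to
    be square-summable only over \<open>UNIV\<close>.\<close>
  have "row_op R (F k) \<in> l2 UNIV" for k
    by (intro finite_support_l2 finite_support_row_op R F(2))
  moreover have "row_op R f \<in> l2 UNIV"
    using op_domD(2)[OF f] l2_mono by blast
  ultimately have "(\<lambda>k. l2_inner g (row_op R (F k))) \<longlonglongrightarrow> l2_inner g (row_op R f)"
    using F(4) g(1) by (intro tendsto_l2_inner_right)
  moreover have "l2_inner g (row_op R (F k)) = l2_inner (row_op (\<lambda>x v. R v x) g) (F k)" for k
    using l2_inner_row_op_finite_support[OF R F(2), of k g]
    by (simp add: l2_inner_commute[of g] l2_inner_commute[of "row_op (\<lambda>x v. R v x) g"])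
  moreover have "(\<lambda>k. l2_inner (row_op (\<lambda>x v. R v x) g) (F k)) \<longlonglongrightarrow> l2_inner (row_op (\<lambda>x v. R v x) g) f"
    by (rule tendsto_l2_inner_right[OF g(2) F(1) op_domD(1)[OF f] F(3)])
  ultimately show ?thesis
    using LIMSEQ_unique by simp
qed

lemma linear_subspace_op_dom:
  assumes R: "\<And>x. finite {v. R x v}"
  shows "linear_subspace (op_dom V (row_op R))"
  unfolding linear_subspace_def
proof (intro conjI ballI allI)
  show "(\<lambda>v. 0) \<in> op_dom V (row_op R)"
    unfolding op_dom_def
    by (intro CollectI conjI exI[of _ "\<lambda>k v. 0"]) (simp_all add: l2_zero row_op_zero l2_norm_zero)
next
  fix f g assume fg: "f \<in> op_dom V (row_op R)" "g \<in> op_dom V (row_op R)"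
  obtain F where F: "\<And>k. F k \<in> l2 V" "\<And>k. finite {v. F k v \<noteq> 0}"
    "(\<lambda>k. l2_norm (\<lambda>v. F k v - f v)) \<longlonglongrightarrow> 0"
    "(\<lambda>k. l2_norm (\<lambda>v. row_op R (F k) v - row_op R f v)) \<longlonglongrightarrow> 0"
    using fg(1) unfolding op_dom_def by blast
  obtain G where G: "\<And>k. G k \<in> l2 V" "\<And>k. finite {v. G k v \<noteq> 0}"
    "(\<lambda>k. l2_norm (\<lambda>v. G k v - g v)) \<longlonglongrightarrow> 0"
    "(\<lambda>k. l2_norm (\<lambda>v. row_op R (G k) v - row_op R g v)) \<longlonglongrightarrow> 0"
    using fg(2) unfolding op_dom_def by blast
  \<comment> \<open>Applied both to the vectors and to their images, hence stated over
    \<open>UNIV\<close>.\<close>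
  have lim: "(\<lambda>k. l2_norm (\<lambda>v. (P k v + Q k v) - (p v + q v))) \<longlonglongrightarrow> 0"
    if P: "\<And>k. P k \<in> l2 UNIV" "p \<in> l2 UNIV" "(\<lambda>k. l2_norm (\<lambda>v. P k v - p v)) \<longlonglongrightarrow> 0"
      and Q: "\<And>k. Q k \<in> l2 UNIV" "q \<in> l2 UNIV" "(\<lambda>k. l2_norm (\<lambda>v. Q k v - q v)) \<longlonglongrightarrow> 0"
    for P Q :: "nat \<Rightarrow> 'a \<Rightarrow> complex" and p q
  proof (rule Lim_null_comparison)
    show "\<forall>\<^sub>F k in sequentially. norm (l2_norm (\<lambda>v. (P k v + Q k v) - (p v + q v)))
        \<le> l2_norm (\<lambda>v. P k v - p v) + l2_norm (\<lambda>v. Q k v - q v)"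
      using l2_norm_add_le[OF l2_diff[OF P(1,2)] l2_diff[OF Q(1,2)]]
      by (simp add: l2_norm_nonneg algebra_simps)
    show "(\<lambda>k. l2_norm (\<lambda>v. P k v - p v) + l2_norm (\<lambda>v. Q k v - q v)) \<longlonglongrightarrow> 0"
      using tendsto_add[OF P(3) Q(3)] by simp
  qed
  have UNIV: "h \<in> l2 UNIV" if "h \<in> l2 V" for h
    using that l2_mono by blast
  show "(\<lambda>v. f v + g v) \<in> op_dom V (row_op R)"
    unfolding op_dom_def
  proof (intro CollectI conjI exI[of _ "\<lambda>k v. F k v + G k v"] allI)
    show "(\<lambda>v. f v + g v) \<in> l2 V" "row_op R (\<lambda>v. f v + g v) \<in> l2 V"
      using fg by (auto simp: row_op_add intro: l2_add dest: op_domD)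
    show "(\<lambda>v. F k v + G k v) \<in> l2 V" for k
      by (intro l2_add F G)
    show "finite {v. F k v + G k v \<noteq> 0}" for k
      by (rule finite_subset[of _ "{v. F k v \<noteq> 0} \<union> {v. G k v \<noteq> 0}"]) (auto simp: F G)
    show "(\<lambda>k. l2_norm (\<lambda>v. F k v + G k v - (f v + g v))) \<longlonglongrightarrow> 0"
      using F G fg by (intro lim) (auto intro: UNIV op_domD)
    show "(\<lambda>k. l2_norm (\<lambda>v. row_op R (\<lambda>v. F k v + G k v) v - row_op R (\<lambda>v. f v + g v) v)) \<longlonglongrightarrow> 0"
      unfolding row_op_add
      by (intro lim F(4) G(4) UNIV[OF op_domD(2)] fg finite_support_l2[OF finite_support_row_op[OF R]] F(2) G(2))
  qed
next
  fix c f assume f: "f \<in> op_dom V (row_op R)"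
  obtain F where F: "\<And>k. F k \<in> l2 V" "\<And>k. finite {v. F k v \<noteq> 0}"
    "(\<lambda>k. l2_norm (\<lambda>v. F k v - f v)) \<longlonglongrightarrow> 0"
    "(\<lambda>k. l2_norm (\<lambda>v. row_op R (F k) v - row_op R f v)) \<longlonglongrightarrow> 0"
    using f unfolding op_dom_def by blast
  show "(\<lambda>v. c * f v) \<in> op_dom V (row_op R)"
    unfolding op_dom_def
  proof (intro CollectI conjI exI[of _ "\<lambda>k v. c * F k v"] allI)
    show "(\<lambda>v. c * f v) \<in> l2 V" "row_op R (\<lambda>v. c * f v) \<in> l2 V"
      using f by (auto simp: row_op_scale intro: l2_scale dest: op_domD)
    show "(\<lambda>v. c * F k v) \<in> l2 V" for k
      by (intro l2_scale F)
    show "finite {v. c * F k v \<noteq> 0}" for k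
      by (rule finite_subset[OF _ F(2)[of k]]) auto
    show "(\<lambda>k. l2_norm (\<lambda>v. c * F k v - c * f v)) \<longlonglongrightarrow> 0"
      using tendsto_mult_left[OF F(3), of "cmod c"]
      by (simp add: l2_norm_scale right_diff_distrib[symmetric])
    show "(\<lambda>k. l2_norm (\<lambda>v. row_op R (\<lambda>v. c * F k v) v - row_op R (\<lambda>v. c * f v) v)) \<longlonglongrightarrow> 0"
      using tendsto_mult_left[OF F(4), of "cmod c"]
      by (simp add: row_op_scale l2_norm_scale right_diff_distrib[symmetric])
  qed
qed

section \<open>Jacobi chains\<close>

lemma adj_op_eq_row_op: "adj_op E = row_op (\<lambda>x v. {x, v} \<in> E)"
  by (simp add: fun_eq_iff adj_op_def row_op_def)

lemma plus_op_eq_row_op: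
  "plus_op E V0 = row_op (\<lambda>x v. {x, v} \<in> E \<and> level E V0 v = level E V0 x + 1)"
  by (simp add: fun_eq_iff plus_op_def row_op_def)

lemma zero_op_eq_row_op:
  "zero_op E V0 = row_op (\<lambda>x v. {x, v} \<in> E \<and> level E V0 v = level E V0 x)"
  by (simp add: fun_eq_iff zero_op_def row_op_def)

lemma minus_op_eq_row_op:
  "minus_op E V0 = row_op (\<lambda>x v. {x, v} \<in> E \<and> level E V0 v + 1 = level E V0 x)"
  by (simp add: fun_eq_iff minus_op_def row_op_def)

lemma finite_edge_restrict:
  assumes "simple_graph V E"
  shows "finite {v. {x, v} \<in> E \<and> P x v}" "finite {x. {x, v} \<in> E \<and> P x v}"
  using finite_neighbours[OF assms] by auto

text \<open>Carries domain membership from the chain vectors to the powers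
  \<open>(adj_op E ^^ n) \<xi>\<close>, which are linear combinations of them.\<close>

lemma linear_subspace_adj_dom:
  assumes "simple_graph V E"
  shows "linear_subspace (adj_dom V E V0)"
proof -
  have "linear_subspace (op_dom V (plus_op E V0))" "linear_subspace (op_dom V (zero_op E V0))"
    "linear_subspace (op_dom V (minus_op E V0))"
    unfolding plus_op_eq_row_op zero_op_eq_row_op minus_op_eq_row_op
    by (intro linear_subspace_op_dom finite_edge_restrict[OF assms])+
  then show ?thesis
    by (simp add: adj_dom_def linear_subspace_def)
qed

text \<open>Reversing an edge exchanges the level conditions of A^+ and A^-, so their matrices are
  transposes of each other. The finitely supported approximation takes place on the side of
  \<open>f\<close>.\<close>

lemma l2_inner_minus_op:
  assumes "simple_graph V E" "f \<in> op_dom V (minus_op E V0)" "g \<in> l2 V" "plus_op E V0 g \<in> l2 V"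
  shows "l2_inner g (minus_op E V0 f) = l2_inner (plus_op E V0 g) f"
proof -
  have "plus_op E V0 = row_op (\<lambda>x v. {v, x} \<in> E \<and> level E V0 x + 1 = level E V0 v)"
    unfolding plus_op_eq_row_op by (intro arg_cong[of _ _ row_op]) (auto simp: fun_eq_iff insert_commute)
  then show ?thesis
    using assms(2-4) unfolding minus_op_eq_row_op
    by (simp only:) (intro l2_inner_row_op finite_edge_restrict[OF assms(1)])
qed

lemma J_vacuum_vectorD:
  assumes "J_vacuum_vector V E V0 \<xi>"
  obtains \<omega> \<alpha> :: "nat \<Rightarrow> real" where
    "\<And>n. (plus_op E V0 ^^ n) \<xi> \<in> adj_dom V E V0"
    "minus_op E V0 \<xi> = (\<lambda>v. 0)"
    "\<And>n. minus_op E V0 ((plus_op E V0 ^^ Suc n) \<xi>) = (\<lambda>v. of_real (\<omega> n) * (plus_op E V0 ^^ n) \<xi> v)"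
    "\<And>n. zero_op E V0 ((plus_op E V0 ^^ n) \<xi>) = (\<lambda>v. of_real (\<alpha> n) * (plus_op E V0 ^^ n) \<xi> v)"
proof -
  obtain \<omega> \<alpha> :: "nat \<Rightarrow> real" where J: "\<And>n.
      (plus_op E V0 ^^ n) \<xi> \<in> op_dom V (plus_op E V0) \<and>
      plus_op E V0 ((plus_op E V0 ^^ n) \<xi>) \<in> op_dom V (minus_op E V0) \<and>
      minus_op E V0 (plus_op E V0 ((plus_op E V0 ^^ n) \<xi>)) = (\<lambda>v. of_real (\<omega> n) * (plus_op E V0 ^^ n) \<xi> v) \<and>
      (plus_op E V0 ^^ n) \<xi> \<in> op_dom V (zero_op E V0) \<and>
      zero_op E V0 ((plus_op E V0 ^^ n) \<xi>) = (\<lambda>v. of_real (\<alpha> n) * (plus_op E V0 ^^ n) \<xi> v)"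
    using assms unfolding J_vacuum_vector_def Let_def by blast
  have vac: "\<xi> \<in> op_dom V (minus_op E V0)" "minus_op E V0 \<xi> = (\<lambda>v. 0)"
    using assms by (auto simp: J_vacuum_vector_def vacuum_vector_def)
  have "(plus_op E V0 ^^ n) \<xi> \<in> op_dom V (minus_op E V0)" for n
    using vac(1) J by (cases n) auto
  then show ?thesis
    using J vac(2) by (intro that) (auto simp: adj_dom_def)
qed

text \<open>Induction on \<open>i\<close> with \<open>j\<close> free. The descent ends at a vacuum
  vector hit by A^- or, when \<open>i\<close> = \<open>j\<close>, at the inner product in
  \<open>orth\<close>.\<close>

lemma chains_orthogonal:
  assumes G: "simple_graph V E"
    and J: "J_vacuum_vector V E V0 \<xi>" "J_vacuum_vector V E V0 \<eta>" and orth: "l2_inner \<xi> \<eta> = 0"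
  shows "l2_inner ((plus_op E V0 ^^ i) \<xi>) ((plus_op E V0 ^^ j) \<eta>) = 0"
proof -
  let ?P = "\<lambda>k \<zeta>. (plus_op E V0 ^^ k) \<zeta>"
  \<comment> \<open>One A^+ on the left becomes an A^- on the right. The vectors are arbitrary
    because the base case exchanges their roles.\<close>
  have down: "l2_inner (?P (Suc i) \<zeta>) (?P j \<theta>) = l2_inner (?P i \<zeta>) (minus_op E V0 (?P j \<theta>))"
    if "J_vacuum_vector V E V0 \<zeta>" "J_vacuum_vector V E V0 \<theta>" for i j \<zeta> \<theta>
  proof -
    have \<zeta>: "?P i \<zeta> \<in> adj_dom V E V0" and \<theta>: "?P j \<theta> \<in> adj_dom V E V0"
      using that by (meson J_vacuum_vectorD)+
    show ?thesis
      using l2_inner_minus_op[OF G, of "?P j \<theta>" V0 "?P i \<zeta>"] \<zeta> \<theta>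
      by (simp add: adj_dom_def op_domD[of _ V "plus_op E V0"])
  qed
  show ?thesis
  proof (induction i arbitrary: j)
    case 0
    show ?case
    proof (cases j)
      case (Suc k)
      \<comment> \<open>Here the A^+ sits on the chain of \<eta>; moved across, it annihilates
        \<xi>, so the arguments have to be swapped.\<close>
      have "minus_op E V0 \<xi> = (\<lambda>v. 0)"
        using J(1) by (meson J_vacuum_vectorD)
      then have "l2_inner (?P j \<eta>) \<xi> = 0"
        using down[OF J(2,1), of k 0] Suc by (simp add: l2_inner_zero_right)
      then show ?thesis by (simp add: l2_inner_commute[of \<xi>])
    qed (simp add: orth)
  next
    case (Suc i)
    obtain \<omega> :: "nat \<Rightarrow> real" where \<omega>: "minus_op E V0 \<eta> = (\<lambda>v. 0)"
      "\<And>n. minus_op E V0 (?P (Suc n) \<eta>) = (\<lambda>v. of_real (\<omega> n) * ?P n \<eta> v)"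
      using J(2) by (meson J_vacuum_vectorD)
    show ?case
    proof (cases j)
      case 0
      then show ?thesis
        using down[OF J, of i 0] \<omega>(1) by (simp add: l2_inner_zero_right)
    next
      case j: (Suc k)
      show ?thesis
        \<comment> \<open>A^- lowers the chain of \<eta> by one index at the cost of the factor
          \<open>\<omega> k\<close>; the induction hypothesis then applies at
          \<open>k\<close>.\<close>
        unfolding j down[OF J] \<omega>(2) l2_inner_scale_right by (simp add: Suc)
    qed
  qed
qed

text \<open>A is tridiagonal on the chain, so the span of the chain is invariant and contains all
  powers. Conversely, the next chain vector has coefficient 1 in the recurrence, which can therefore
  be solved for it.\<close>

lemma
  assumes G: "simple_graph V E" "V0 \<subseteq> V" "V0 \<noteq> {}" and J: "J_vacuum_vector V E V0 \<xi>"
  shows adj_powers_in_chain_span: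
      "(adj_op E ^^ n) \<xi> \<in> lin_span (range (\<lambda>k. (plus_op E V0 ^^ k) \<xi>))" (is "_ \<in> ?L")
    and chain_in_adj_powers_span:
      "(plus_op E V0 ^^ n) \<xi> \<in> lin_span (range (\<lambda>k. (adj_op E ^^ k) \<xi>))" (is "_ \<in> ?K")
proof -
  let ?P = "\<lambda>k. (plus_op E V0 ^^ k) \<xi>"
  obtain \<omega> \<alpha> :: "nat \<Rightarrow> real" where vac: "minus_op E V0 \<xi> = (\<lambda>v. 0)"
    and \<omega>: "\<And>n. minus_op E V0 (?P (Suc n)) = (\<lambda>v. of_real (\<omega> n) * ?P n v)"
    and \<alpha>: "\<And>n. zero_op E V0 (?P n) = (\<lambda>v. of_real (\<alpha> n) * ?P n v)"
    using J by (meson J_vacuum_vectorD)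
  \<comment> \<open>The A^- term stays unevaluated: it vanishes for \<open>n\<close> = 0 and is a
    multiple of the preceding chain vector otherwise.\<close>
  have A: "adj_op E (?P n) = (\<lambda>v. ?P (Suc n) v + of_real (\<alpha> n) * ?P n v + minus_op E V0 (?P n) v)" for n
    using quantum_decomposition[OF G] by (simp add: fun_eq_iff \<alpha>)
  note L = linear_subspaceD[OF linear_subspace_lin_span[of "range ?P"]]
  note K = linear_subspaceD[OF linear_subspace_lin_span[of "range (\<lambda>k. (adj_op E ^^ k) \<xi>)"]]
  have PL: "?P n \<in> ?L" for n by (rule subsetD[OF lin_span_superset rangeI])
  have AK: "(adj_op E ^^ n) \<xi> \<in> ?K" for n by (rule subsetD[OF lin_span_superset rangeI])
  have "adj_op E (?P n) \<in> ?L" for n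
  proof -
    have "minus_op E V0 (?P n) \<in> ?L"
      using \<omega> vac L(1) L(3)[OF PL] by (cases n) auto
    then show ?thesis unfolding A by (intro L(2) L(3) PL)
  qed
  then have "?L \<subseteq> {f. adj_op E f \<in> ?L}"
    unfolding adj_op_eq_row_op
    by (intro lin_span_minimal linear_subspace_row_op_vimage linear_subspace_lin_span) auto
  then show "(adj_op E ^^ n) \<xi> \<in> ?L"
    using PL[of 0] by (induction n) auto
  have "adj_op E ((adj_op E ^^ n) \<xi>) \<in> ?K" for n
    using AK[of "Suc n"] by simp
  then have AK': "?K \<subseteq> {f. adj_op E f \<in> ?K}"
    unfolding adj_op_eq_row_op
    by (intro lin_span_minimal linear_subspace_row_op_vimage linear_subspace_lin_span) auto
  show "?P n \<in> ?K"
  \<comment> \<open>Strong induction, as the recurrence reaches back two indices.\<close>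
  proof (induction n rule: less_induct)
    case (less n)
    show ?case
    proof (cases n)
      case 0
      then show ?thesis using AK[of 0] by simp
    next
      case (Suc k)
      have Pk: "?P k \<in> ?K" using less Suc by simp
      have M: "minus_op E V0 (?P k) \<in> ?K"
      proof (cases k)
        case (Suc l)
        then have "?P l \<in> ?K" using less \<open>n = Suc k\<close> by simp
        then show ?thesis unfolding Suc \<omega> by (rule K(3))
      qed (simp add: vac K(1))
      have "(\<lambda>v. adj_op E (?P k) v - (of_real (\<alpha> k) * ?P k v + minus_op E V0 (?P k) v)) \<in> ?K"
        using AK' Pk M by (intro linear_subspace_diff linear_subspace_lin_span K(2) K(3)) auto
      moreover have "?P n = (\<lambda>v. adj_op E (?P k) v - (of_real (\<alpha> k) * ?P k v + minus_op E V0 (?P k) v))"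
        unfolding A Suc by simp
      ultimately show ?thesis by simp
    qed
  qed
qed

text \<open>\<open>closed_span\<close> sees its generators only through \<open>lin_span\<close>, so
  equality of the algebraic spans suffices.\<close>

lemma cyclic_subspace_eq_chain_closed_span:
  assumes G: "simple_graph V E" "V0 \<subseteq> V" "V0 \<noteq> {}" and J: "J_vacuum_vector V E V0 \<xi>"
  shows "cyclic_subspace V E \<xi> = closed_span V (range (\<lambda>k. (plus_op E V0 ^^ k) \<xi>))"
proof -
  have "lin_span (range (\<lambda>k. (adj_op E ^^ k) \<xi>)) = lin_span (range (\<lambda>k. (plus_op E V0 ^^ k) \<xi>))"
    using adj_powers_in_chain_span[OF assms] chain_in_adj_powers_span[OF assms]
    by (intro equalityI lin_span_minimal linear_subspace_lin_span) auto
  then show ?thesis by (simp add: cyclic_subspace_def closed_span_def)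
qed

text \<open>Each new level either applies A^+ to a chain vector, raising its index, or introduces a
  vector that starts its own chain at index 0.\<close>

lemma generated_level_in_chains:
  "b \<in> generated_level E V0 \<Xi>n n \<Longrightarrow> \<exists>\<xi>\<in>(\<Union>m. \<Xi>n m). \<exists>k. b = (plus_op E V0 ^^ k) \<xi>"
proof (induction n arbitrary: b)
  case 0
  then show ?case by (intro bexI[of _ b] exI[of _ 0]) auto
next
  case (Suc n)
  then consider a where "a \<in> generated_level E V0 \<Xi>n n" "b = plus_op E V0 a" | "b \<in> \<Xi>n (Suc n)"
    by auto
  then show ?case
  proof cases
    case 1
    then obtain \<xi> k where "\<xi> \<in> (\<Union>m. \<Xi>n m)" "b = (plus_op E V0 ^^ Suc k) \<xi>"
      using Suc.IH by fastforce
    then show ?thesis by blast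
  next
    case 2
    then show ?thesis by (intro bexI[of _ b] exI[of _ 0]) auto
  qed
qed

text \<open>The conjunct on domains makes the powers in \<open>cyclic_subspace\<close>, formed by
  the matrix formula on arbitrary functions, genuine iterates of the operator A.\<close>

theorem theorem9p3:
  fixes V V0 :: "'v set" and E :: "'v set set"
    and \<Xi> :: "('v \<Rightarrow> complex) set" and \<Xi>n :: "nat \<Rightarrow> ('v \<Rightarrow> complex) set"
  assumes "simple_graph V E"
    and "V0 \<subseteq> V" and "V0 \<noteq> {}"
    and "orthogonal_J_vacuum_set V E V0 \<Xi>"
    and "distance_adapted V E V0 \<Xi> \<Xi>n"
    and "generating V E V0 \<Xi>n"
  shows "(\<forall>\<xi>\<in>\<Xi>. \<forall>n. (adj_op E ^^ n) \<xi> \<in> adj_dom V E V0) \<and>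
         orthogonal_direct_sum V \<Xi> (cyclic_subspace V E)"
proof
  let ?P = "\<lambda>k \<xi>. (plus_op E V0 ^^ k) \<xi>"
  have J: "J_vacuum_vector V E V0 \<xi>" if "\<xi> \<in> \<Xi>" for \<xi>
    using assms(4) that by (simp add: orthogonal_J_vacuum_set_def)
  have dom: "?P k \<xi> \<in> adj_dom V E V0" if "\<xi> \<in> \<Xi>" for k \<xi>
    using J[OF that] by (meson J_vacuum_vectorD)
  have l2: "?P k \<xi> \<in> l2 V" if "\<xi> \<in> \<Xi>" for k \<xi>
    using dom[OF that] by (auto simp: adj_dom_def dest: op_domD)
  show "\<forall>\<xi>\<in>\<Xi>. \<forall>n. (adj_op E ^^ n) \<xi> \<in> adj_dom V E V0"
  proof (intro ballI allI)
    fix \<xi> n assume \<xi>: "\<xi> \<in> \<Xi>"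
    have "lin_span (range (\<lambda>k. ?P k \<xi>)) \<subseteq> adj_dom V E V0"
      using dom[OF \<xi>] by (intro lin_span_minimal linear_subspace_adj_dom[OF assms(1)]) auto
    then show "(adj_op E ^^ n) \<xi> \<in> adj_dom V E V0"
      using adj_powers_in_chain_span[OF assms(1-3) J[OF \<xi>]] by blast
  qed
  have cyc: "cyclic_subspace V E \<xi> = closed_span V (range (\<lambda>k. ?P k \<xi>))" if "\<xi> \<in> \<Xi>" for \<xi>
    by (rule cyclic_subspace_eq_chain_closed_span[OF assms(1-3) J[OF that]])
  show "orthogonal_direct_sum V \<Xi> (cyclic_subspace V E)"
    unfolding orthogonal_direct_sum_def
  proof (intro conjI ballI impI)
    show "closed_span V (cyclic_subspace V E \<xi>) = cyclic_subspace V E \<xi>" for \<xi>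
      by (simp add: cyclic_subspace_def closed_span_idem)
  next
    fix \<xi> \<eta> f g
    assume \<xi>: "\<xi> \<in> \<Xi>" and \<eta>: "\<eta> \<in> \<Xi>" and "\<xi> \<noteq> \<eta>"
      and fg: "f \<in> cyclic_subspace V E \<xi>" "g \<in> cyclic_subspace V E \<eta>"
    then have "l2_inner \<xi> \<eta> = 0"
      using assms(4) by (simp add: orthogonal_J_vacuum_set_def pairwise_def)
    then have "l2_inner (?P i \<xi>) (?P j \<eta>) = 0" for i j
      by (rule chains_orthogonal[OF assms(1) J[OF \<xi>] J[OF \<eta>]])
    then have "l2_inner b c = 0" if "b \<in> range (\<lambda>k. ?P k \<xi>)" "c \<in> range (\<lambda>k. ?P k \<eta>)" for b c
      using that by blast
    moreover have "range (\<lambda>k. ?P k \<xi>) \<subseteq> l2 V" "range (\<lambda>k. ?P k \<eta>) \<subseteq> l2 V"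
      using l2 \<xi> \<eta> by blast+
    ultimately show "l2_inner f g = 0"
      using closed_span_orthogonal fg unfolding cyc[OF \<xi>] cyc[OF \<eta>] by blast
  next
    let ?M = "closed_span V (\<Union>\<xi>\<in>\<Xi>. cyclic_subspace V E \<xi>)"
    show "?M = l2 V"
    proof (rule closed_subspace_deltas[OF closed_subspace_closed_span])
      fix x assume x: "x \<in> V"
      \<comment> \<open>Each vertex lies in the stratum of its own level, where the generating
        property can be applied to its point mass.\<close>
      define n where "n = level E V0 x"
      have "delta x \<in> l2 (stratum V E V0 n)"
        using x by (intro delta_l2) (simp add: stratum_def n_def)
      then have "delta x \<in> closed_span (stratum V E V0 n) (generated_level E V0 \<Xi>n n)"
        using assms(6) by (simp add: generating_def l2_basis_def)
      \<comment> \<open>Functions on a stratum already are functions on \<open>V\<close> vanishing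
        elsewhere, so the approximations remain valid in the larger carrier.\<close>
      then have delta: "delta x \<in> closed_span V (generated_level E V0 \<Xi>n n)"
        using closed_span_mono_carrier[of "stratum V E V0 n" V] by (auto simp: stratum_def)
      \<comment> \<open>A generated vector lies on some chain, hence in a cyclic subspace; being
        closed, \<open>?M\<close> then contains the closed span of all of them.\<close>
      have "generated_level E V0 \<Xi>n n \<subseteq> ?M"
      proof
        fix b assume "b \<in> generated_level E V0 \<Xi>n n"
        then obtain \<xi> k where \<xi>: "\<xi> \<in> \<Xi>" "b = ?P k \<xi>"
          using generated_level_in_chains assms(5) by (metis distance_adapted_def)
        then have "b \<in> cyclic_subspace V E \<xi>"
          using cyc closed_span_superset[of "range (\<lambda>k. ?P k \<xi>)" V] l2 by auto
        then show "b \<in> ?M"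
          using \<xi> l2 closed_span_superset[of "\<Union>\<xi>\<in>\<Xi>. cyclic_subspace V E \<xi>" V] by auto
      qed
      then show "delta x \<in> ?M"
        using closed_span_minimal[OF closed_subspace_closed_span] delta by blast
    qed
  qed
qed

end
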